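(* ($\mathcal L_p$-Local Technique Lemma.) Let $n\in\mathbb N$, $1\le p\le\infty$, $1\le\lambda<\infty$, let $\alpha$ and $\beta$ be s-tensor norms of order $n$, and let $c\ge0$ be such that $$\alpha\le c\,\beta\quad\text{on }\otimes^{n,s}\ell_p^m$$ for every $m\in\mathbb N$. If $E$ is a normed $\mathcal L^g_{p,\lambda}$-space, then $$\alpha\le\lambda^n c\,\overrightarrow{\beta}\quad\text{on }\otimes^{n,s}E.$$
   Context: Normed spaces are over $\mathbb K=\mathbb R$ or $\mathbb C$. $FIN(E)$ is the set of finite dimensional subspaces of $E$; $\mathcal L(E,F)$ is the space of continuous linear operators; $\ell_p^m$ is $\mathbb K^m$ with the $\ell_p$-norm. $\otimes^{n,s}E$ is the linear span in $\otimes^nE$ of the elements $\otimes^n x=x\otimes\cdots\otimes x$, $x\in E$. For $T\in\mathcal L(E,F)$, $\otimes^{n,s}T$ is the linear map with $\otimes^n x\mapsto\otimes^n(Tx)$. For $z\in\otimes^{n,s}E$: $\pi_s(z)=\inf\{\sum_j|\lambda_j|\|x_j\|^n\}$ over all representations $z=\sum_{j=1}^r\lambda_j\otimes^n x_j$, and $\varepsilon_s(z)=\sup_{x'\in B_{E'}}|\sum_j\lambda_j x'(x_j)^n|$ for any such representation. An s-tensor norm $\alpha$ of order $n$ assigns to each normed space $E$ a norm $\alpha(\,\cdot\,;\otimes^{n,s}E)$ on $\otimes^{n,s}E$ such that (1) $\varepsilon_s\le\alpha\le\pi_s$ and (2) $\alpha((\otimes^{n,s}T)z;\otimes^{n,s}F)\le\|T\|^n\alpha(z;\otimes^{n,s}E)$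 for all $T\in\mathcal L(E,F)$, $z\in\otimes^{n,s}E$. "$\alpha\le c\beta$ on $\otimes^{n,s}E$" means $\alpha(z;\otimes^{n,s}E)\le c\,\beta(z;\otimes^{n,s}E)$ for all $z\in\otimes^{n,s}E$. The finite hull of $\beta$ is $\overrightarrow\beta(z;\otimes^{n,s}E)=\inf\{\beta(z;\otimes^{n,s}M):M\in FIN(E),\ z\in\otimes^{n,s}M\}$. A normed space $E$ is an $\mathcal L^g_{p,\lambda}$-space if for each $M\in FIN(E)$ and $\varepsilon>0$ there are $m\in\mathbb N$, $R\in\mathcal L(M,\ell_p^m)$ and $S\in\mathcal L(\ell_p^m,E)$ such that $S\circ R$ is the inclusion $M\hookrightarrow E$ and $\|S\|\|R\|\le\lambda+\varepsilon$. *)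

theory Defs
  imports Complex_Main "HOL-Algebra.Module" "HOL-Library.Extended_Real"
begin

section \<open>Normed spaces with explicit carrier\<close>

text \<open>
  The scalar field is a type \<open>'k\<close> of class \<open>real_normed_field\<close>.  Its norm is multiplicative, so by
  the theorems of Ostrowski and Gelfand-Mazur \<open>'k\<close> is, up to isometric isomorphism, \<open>real\<close> or
  \<open>complex\<close>.
\<close>

definition scalars :: "'k::real_normed_field ring" where
  "scalars = \<lparr>carrier = UNIV, mult = (*), one = 1, zero = 0, add = (+)\<rparr>"

lemma scalars_simps [simp]:
  "carrier scalars = UNIV" "a \<otimes>\<^bsub>scalars\<^esub> b = a * b" "\<one>\<^bsub>scalars\<^esub> = 1"
  "\<zero>\<^bsub>scalars\<^esub> = 0" "a \<oplus>\<^bsub>scalars\<^esub> b = a + b"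
  by (simp_all add: scalars_def)

lemma field_scalars: "field (scalars :: 'k::real_normed_field ring)"
proof -
  have "cring (scalars :: 'k ring)"
  proof (rule cringI)
    show "abelian_group (scalars :: 'k ring)"
    proof (rule abelian_groupI)
      show "\<exists>y\<in>carrier scalars. y \<oplus>\<^bsub>scalars\<^esub> x = \<zero>\<^bsub>scalars\<^esub>" for x :: 'k
        by (rule bexI[of _ "- x"]) auto
    qed auto
    show "Group.comm_monoid (scalars :: 'k ring)"
      by (rule comm_monoidI) auto
  qed (auto simp: algebra_simps)
  then show ?thesis
  proof (rule cring.cring_fieldI2)
    show "\<zero>\<^bsub>scalars\<^esub> \<noteq> (\<one>\<^bsub>scalars\<^esub> :: 'k)" by simp
    show "\<exists>b\<in>carrier scalars. a \<otimes>\<^bsub>scalars\<^esub> b = \<one>\<^bsub>scalars\<^esub>" if "a \<noteq> \<zero>\<^bsub>scalars\<^esub>" for a :: 'k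
      using that by (intro bexI[of _ "inverse a"]) auto
  qed
qed

text \<open>The fields \<open>mult\<close> and \<open>one\<close> that \<open>module\<close> inherits from \<open>ring\<close> play no role.\<close>

record ('k, 'u) nspace = "('k, 'u) module" +
  nrm :: "'u \<Rightarrow> real"

definition is_norm :: "('k::real_normed_field, 'u, 'z) module_scheme \<Rightarrow> ('u \<Rightarrow> real) \<Rightarrow> bool" where
  "is_norm V \<nu> \<longleftrightarrow>
     (\<forall>x\<in>carrier V. 0 \<le> \<nu> x \<and> (\<nu> x = 0 \<longleftrightarrow> x = \<zero>\<^bsub>V\<^esub>)) \<and>
     (\<forall>x\<in>carrier V. \<forall>y\<in>carrier V. \<nu> (x \<oplus>\<^bsub>V\<^esub> y) \<le> \<nu> x + \<nu> y) \<and>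
     (\<forall>a. \<forall>x\<in>carrier V. \<nu> (a \<odot>\<^bsub>V\<^esub> x) = norm a * \<nu> x)"

definition normed_space :: "('k::real_normed_field, 'u) nspace \<Rightarrow> bool" where
  "normed_space E \<longleftrightarrow> Module.module scalars E \<and> is_norm E (nrm E)"

definition FIN :: "('k::real_normed_field, 'u) nspace \<Rightarrow> ('k, 'u) nspace set" where
  "FIN E = {E\<lparr>carrier := M\<rparr> | M. submodule M scalars E \<and>
     (\<exists>B. finite B \<and> B \<subseteq> carrier E \<and> M = {(\<Oplus>\<^bsub>E\<^esub>b\<in>B. a b \<odot>\<^bsub>E\<^esub> b) | a. True})}"

definition linear_op ::
  "('k::real_normed_field, 'u) nspace \<Rightarrow> ('k, 'v) nspace \<Rightarrow> ('u \<Rightarrow> 'v) \<Rightarrow> bool" where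
  "linear_op E F T \<longleftrightarrow> T \<in> carrier E \<rightarrow> carrier F \<and>
     (\<forall>x\<in>carrier E. \<forall>y\<in>carrier E. T (x \<oplus>\<^bsub>E\<^esub> y) = T x \<oplus>\<^bsub>F\<^esub> T y) \<and>
     (\<forall>a. \<forall>x\<in>carrier E. T (a \<odot>\<^bsub>E\<^esub> x) = a \<odot>\<^bsub>F\<^esub> T x)"

definition bounded_ops ::
  "('k::real_normed_field, 'u) nspace \<Rightarrow> ('k, 'v) nspace \<Rightarrow> ('u \<Rightarrow> 'v) set" where
  "bounded_ops E F =
     {T. linear_op E F T \<and> (\<exists>C. \<forall>x\<in>carrier E. nrm F (T x) \<le> C * nrm E x)}"

definition opnorm ::
  "('k::real_normed_field, 'u) nspace \<Rightarrow> ('k, 'v) nspace \<Rightarrow> ('u \<Rightarrow> 'v) \<Rightarrow> real" where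
  "opnorm E F T = Sup {nrm F (T x) | x. x \<in> carrier E \<and> nrm E x \<le> 1}"

definition scalar_space :: "('k::real_normed_field, 'k) nspace" where
  "scalar_space = \<lparr>carrier = UNIV, mult = (*), one = 1, zero = 0, add = (+), smult = (*), nrm = norm\<rparr>"

definition dual_ball :: "('k::real_normed_field, 'u) nspace \<Rightarrow> ('u \<Rightarrow> 'k) set" where
  "dual_ball E = {f \<in> bounded_ops E scalar_space. opnorm E scalar_space f \<le> 1}"

definition lp_norm :: "ereal \<Rightarrow> nat \<Rightarrow> (nat \<Rightarrow> 'k::real_normed_field) \<Rightarrow> real" where
  "lp_norm p m x =
     (if p = \<infinity> then Max (insert 0 ((\<lambda>i. norm (x i)) ` {..<m}))
      else (\<Sum>i<m. norm (x i) powr real_of_ereal p) powr (1 / real_of_ereal p))"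

text \<open>\<open>'k\<^sup>m\<close> is modelled by the sequences supported on \<open>{..<m}\<close>.\<close>

definition ellp :: "ereal \<Rightarrow> nat \<Rightarrow> ('k::real_normed_field, nat \<Rightarrow> 'k) nspace" where
  "ellp p m = \<lparr>carrier = {x. \<forall>i\<ge>m. x i = 0}, mult = undefined, one = undefined,
     zero = (\<lambda>i. 0), add = (\<lambda>x y i. x i + y i), smult = (\<lambda>a x i. a * x i), nrm = lp_norm p m\<rparr>"

definition Lg_space :: "ereal \<Rightarrow> real \<Rightarrow> ('k::real_normed_field, 'u) nspace \<Rightarrow> bool" where
  "Lg_space p l E \<longleftrightarrow> (\<forall>M\<in>FIN E. \<forall>\<epsilon>>0. \<exists>m R S.
     R \<in> bounded_ops M (ellp p m) \<and> S \<in> bounded_ops (ellp p m) E \<and>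
     (\<forall>x\<in>carrier M. S (R x) = x) \<and> opnorm (ellp p m) E S * opnorm M (ellp p m) R \<le> l + \<epsilon>)"


section \<open>Tensor powers\<close>

text \<open>
  The algebraic tensor power of \<open>E\<close> is realised, as in Ryan's book on tensor products of Banach
  spaces, as a space of linear functionals on the \<open>n\<close>-linear forms: the elementary tensor of
  \<open>x\<^sub>1, \<dots>, x\<^sub>n\<close> is evaluation at \<open>(x\<^sub>1, \<dots>, x\<^sub>n)\<close>.  Over a field this is isomorphic to
  the quotient construction, because scalar \<open>n\<close>-linear forms separate its points.  No continuity is
  required of the forms.  To make forms and tensors unique as functions, they take the value 0
  outside their intended domains.
\<close>

type_synonym ('k, 'u) tensor = "('u list \<Rightarrow> 'k) \<Rightarrow> 'k"

definition tuples :: "nat \<Rightarrow> ('k::real_normed_field, 'u) nspace \<Rightarrow> 'u list set" where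
  "tuples n E = {xs. length xs = n \<and> set xs \<subseteq> carrier E}"

definition multilinear_forms ::
  "nat \<Rightarrow> ('k::real_normed_field, 'u) nspace \<Rightarrow> ('u list \<Rightarrow> 'k) set" where
  "multilinear_forms n E = {\<phi>.
     (\<forall>xs\<in>tuples n E. \<forall>i<n. \<forall>x\<in>carrier E. \<forall>y\<in>carrier E.
        \<phi> (xs[i := x \<oplus>\<^bsub>E\<^esub> y]) = \<phi> (xs[i := x]) + \<phi> (xs[i := y])) \<and>
     (\<forall>xs\<in>tuples n E. \<forall>i<n. \<forall>a. \<forall>x\<in>carrier E. \<phi> (xs[i := a \<odot>\<^bsub>E\<^esub> x]) = a * \<phi> (xs[i := x])) \<and>
     (\<forall>xs. xs \<notin> tuples n E \<longrightarrow> \<phi> xs = 0)}"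

definition elem_tensor ::
  "nat \<Rightarrow> ('k::real_normed_field, 'u) nspace \<Rightarrow> 'u list \<Rightarrow> ('k, 'u) tensor" where
  "elem_tensor n E xs = (\<lambda>\<phi>. if \<phi> \<in> multilinear_forms n E then \<phi> xs else 0)"

definition power_tensor ::
  "nat \<Rightarrow> ('k::real_normed_field, 'u) nspace \<Rightarrow> 'u \<Rightarrow> ('k, 'u) tensor" where
  "power_tensor n E x = elem_tensor n E (replicate n x)"

definition represents :: "nat \<Rightarrow> ('k::real_normed_field, 'u) nspace \<Rightarrow>
    nat \<Rightarrow> (nat \<Rightarrow> 'k) \<Rightarrow> (nat \<Rightarrow> 'u) \<Rightarrow> ('k, 'u) tensor \<Rightarrow> bool" where
  "represents n E r a x z \<longleftrightarrow>
     (\<forall>j<r. x j \<in> carrier E) \<and> z = (\<lambda>\<phi>. \<Sum>j<r. a j * power_tensor n E (x j) \<phi>)"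

definition sym_tensors ::
  "nat \<Rightarrow> ('k::real_normed_field, 'u) nspace \<Rightarrow> ('k, ('k, 'u) tensor) module" where
  "sym_tensors n E = \<lparr>carrier = {z. \<exists>r a x. represents n E r a x z}, mult = undefined, one = undefined,
     zero = (\<lambda>\<phi>. 0), add = (\<lambda>z w \<phi>. z \<phi> + w \<phi>), smult = (\<lambda>a z \<phi>. a * z \<phi>)\<rparr>"

text \<open>The linear map sending each power tensor of \<open>x\<close> to the power tensor of \<open>T x\<close>: composition
  with the pull-back of forms along \<open>T\<close>.\<close>

definition pullback :: "nat \<Rightarrow> ('k::real_normed_field, 'u) nspace \<Rightarrow> ('u \<Rightarrow> 'v) \<Rightarrow>
    ('v list \<Rightarrow> 'k) \<Rightarrow> 'u list \<Rightarrow> 'k" where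
  "pullback n E T \<psi> = (\<lambda>xs. if xs \<in> tuples n E then \<psi> (map T xs) else 0)"

definition tensor_map :: "nat \<Rightarrow> ('k::real_normed_field, 'u) nspace \<Rightarrow> ('k, 'v) nspace \<Rightarrow>
    ('u \<Rightarrow> 'v) \<Rightarrow> ('k, 'u) tensor \<Rightarrow> ('k, 'v) tensor" where
  "tensor_map n E F T z = (\<lambda>\<psi>. if \<psi> \<in> multilinear_forms n F then z (pullback n E T \<psi>) else 0)"

lemma tuples_update:
  assumes "xs \<in> tuples n E" "u \<in> carrier E"
  shows "xs[i := u] \<in> tuples n E"
  using assms set_update_subset_insert[of xs i u] by (auto simp: tuples_def)

lemma replicate_tuples: "x \<in> carrier E \<Longrightarrow> replicate n x \<in> tuples n E"
  by (auto simp: tuples_def)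

lemma pullback_multilinear:
  assumes E: "Module.module scalars E" and T: "linear_op E F T" and psi: "\<psi> \<in> multilinear_forms n F"
  shows "pullback n E T \<psi> \<in> multilinear_forms n E"
proof -
  interpret E: Module.module scalars E by (rule E)
  have cl: "T x \<in> carrier F" if "x \<in> carrier E" for x
    using that T by (auto simp: linear_op_def)
  have tup: "map T xs \<in> tuples n F" if "xs \<in> tuples n E" for xs
    using that cl by (auto simp: tuples_def)
  have smult: "a \<odot>\<^bsub>E\<^esub> x \<in> carrier E" if "x \<in> carrier E" for a x
    using that E.smult_closed[of a x] by simp
  show ?thesis
    using psi T cl tup smult
    by (auto simp: multilinear_forms_def pullback_def tuples_update map_update linear_op_def)
qed

lemma tensor_map_power_tensor:
  assumes "Module.module scalars E" "linear_op E F T" "x \<in> carrier E"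
  shows "tensor_map n E F T (power_tensor n E x) = power_tensor n F (T x)"
  using pullback_multilinear[OF assms(1,2)] replicate_tuples[OF assms(3), of n]
  by (auto simp: tensor_map_def power_tensor_def elem_tensor_def pullback_def map_replicate)

lemma tensor_map_linear:
  "tensor_map n E F T (\<lambda>\<phi>. \<Sum>j<(r::nat). a j * z j \<phi>) = (\<lambda>\<psi>. \<Sum>j<r. a j * tensor_map n E F T (z j) \<psi>)"
  by (auto simp: tensor_map_def)

lemma tensor_map_represents:
  assumes "Module.module scalars E" "linear_op E F T" "represents n E r a x z"
  shows "represents n F r a (\<lambda>j. T (x j)) (tensor_map n E F T z)"
  using assms tensor_map_power_tensor[OF assms(1,2)]
  by (auto simp: represents_def tensor_map_linear linear_op_def)


section \<open>s-tensor norms\<close>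

definition pi_s :: "nat \<Rightarrow> ('k::real_normed_field, 'u) nspace \<Rightarrow> ('k, 'u) tensor \<Rightarrow> real" where
  "pi_s n E z = Inf {(\<Sum>j<r. norm (a j) * nrm E (x j) ^ n) | r a x. represents n E r a x z}"

text \<open>The description below does not depend on the representation, see \<open>eps_s_eq\<close>.\<close>

definition eps_s :: "nat \<Rightarrow> ('k::real_normed_field, 'u) nspace \<Rightarrow> ('k, 'u) tensor \<Rightarrow> real" where
  "eps_s n E z = (THE t. \<forall>r a x. represents n E r a x z \<longrightarrow>
     t = (SUP f\<in>dual_ball E. norm (\<Sum>j<r. a j * f (x j) ^ n)))"

lemma prod_form_multilinear:
  assumes E: "Module.module scalars E" and f: "linear_op E scalar_space f"
  shows "(\<lambda>xs. if xs \<in> tuples n E then prod_list (map f xs) else 0) \<in> multilinear_forms n E"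
proof -
  interpret E: Module.module scalars E by (rule E)
  have smult: "a \<odot>\<^bsub>E\<^esub> x \<in> carrier E" if "x \<in> carrier E" for a x
    using that E.smult_closed[of a x] by simp
  have upd: "prod_list (map f (xs[i := u])) =
      prod_list (map f (take i xs)) * (f u * prod_list (map f (drop (Suc i) xs)))"
    if "xs \<in> tuples n E" "i < n" for xs i u
    using that by (simp add: tuples_def upd_conv_take_nth_drop)
  show ?thesis
    using f smult
    by (auto simp: multilinear_forms_def upd tuples_update linear_op_def scalar_space_def algebra_simps)
qed

lemma eps_s_eq:
  assumes E: "Module.module scalars E" and z: "represents n E r a x z"
  shows "eps_s n E z = (SUP f\<in>dual_ball E. norm (\<Sum>j<r. a j * f (x j) ^ n))"
proof -
  let ?P = "\<lambda>f xs. if xs \<in> tuples n E then prod_list (map f xs) else 0"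
  have ev: "z (?P f) = (\<Sum>j<r. a j * f (x j) ^ n)"
    if "f \<in> dual_ball E" "represents n E r a x z" for f r a x
  proof -
    have "?P f \<in> multilinear_forms n E"
      using that(1) by (intro prod_form_multilinear E) (auto simp: dual_ball_def bounded_ops_def)
    then have "power_tensor n E (x j) (?P f) = f (x j) ^ n" if "j < r" for j
      using that \<open>represents n E r a x z\<close> replicate_tuples[of "x j" E n]
      by (auto simp: power_tensor_def elem_tensor_def represents_def)
    with that(2) show ?thesis
      by (simp add: represents_def)
  qed
  have "(SUP f\<in>dual_ball E. norm (\<Sum>j<r. a j * f (x j) ^ n)) = (SUP f\<in>dual_ball E. norm (z (?P f)))"
    if "represents n E r a x z" for r a x
    using that by (intro SUP_cong) (auto simp: ev)
  with z show ?thesis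
    unfolding eps_s_def by (intro the_equality) auto
qed

text \<open>
  HOL cannot quantify over all normed spaces at once, so an s-tensor norm is an assignment on the
  normed spaces whose carrier is a set of elements of the type \<open>'u\<close>.  This class is closed under
  passing to subspaces.
\<close>

definition s_tensor_norm ::
  "nat \<Rightarrow> (('k::real_normed_field, 'u) nspace \<Rightarrow> ('k, 'u) tensor \<Rightarrow> real) \<Rightarrow> bool" where
  "s_tensor_norm n \<alpha> \<longleftrightarrow>
     (\<forall>E. normed_space E \<longrightarrow> is_norm (sym_tensors n E) (\<alpha> E) \<and>
        (\<forall>z\<in>carrier (sym_tensors n E). eps_s n E z \<le> \<alpha> E z \<and> \<alpha> E z \<le> pi_s n E z)) \<and>
     (\<forall>E F. normed_space E \<longrightarrow> normed_space F \<longrightarrow>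
        (\<forall>T\<in>bounded_ops E F. \<forall>z\<in>carrier (sym_tensors n E).
           \<alpha> F (tensor_map n E F T z) \<le> opnorm E F T ^ n * \<alpha> E z))"

text \<open>
  For a subspace \<open>M\<close>, the tensors over \<open>M\<close> are identified with tensors over \<open>E\<close> through the
  (injective) tensor power of the inclusion.
\<close>

definition finite_hull :: "nat \<Rightarrow> (('k::real_normed_field, 'u) nspace \<Rightarrow> ('k, 'u) tensor \<Rightarrow> real) \<Rightarrow>
    ('k, 'u) nspace \<Rightarrow> ('k, 'u) tensor \<Rightarrow> real" where
  "finite_hull n \<beta> E z = Inf {\<beta> M w | M w. M \<in> FIN E \<and> w \<in> carrier (sym_tensors n M) \<and>
     tensor_map n M E (\<lambda>x. x) w = z}"

text \<open>
  In order that the universe of spaces contains every \<open>\<ell>\<^sub>p\<^sup>m\<close>, it is taken to be a sum type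
  \<open>'a + (nat \<Rightarrow> 'k)\<close> with \<open>'a\<close> arbitrary; \<open>ellp_sum p m\<close> is the space \<open>ellp p m\<close> sitting in the
  right summand.
\<close>

definition ellp_sum :: "ereal \<Rightarrow> nat \<Rightarrow> ('k::real_normed_field, 'a + (nat \<Rightarrow> 'k)) nspace" where
  "ellp_sum p m = (let L = ellp p m in
     \<lparr>carrier = Inr ` carrier L, mult = undefined, one = undefined,
      zero = Inr \<zero>\<^bsub>L\<^esub>, add = (\<lambda>u v. Inr (projr u \<oplus>\<^bsub>L\<^esub> projr v)),
      smult = (\<lambda>a u. Inr (a \<odot>\<^bsub>L\<^esub> projr u)), nrm = (\<lambda>u. nrm L (projr u))\<rparr>)"

end

theory Submission
  imports Defs "HOL-Analysis.Convex"
begin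

text \<open>
  The definition of an \<open>\<L>\<^sub>p\<close>-space lets every finite dimensional subspace \<open>M\<close> of \<open>E\<close> pass
  through some \<open>\<ell>\<^sub>p\<^sup>m\<close>: the inclusion is \<open>S \<circ> R\<close> with \<open>\<parallel>S\<parallel> \<parallel>R\<parallel> \<le> l + \<epsilon>\<close>.  Taking tensor powers,
  a tensor \<open>w\<close> over \<open>M\<close> is carried to \<open>\<ell>\<^sub>p\<^sup>m\<close> by \<open>R\<close>, where \<open>\<alpha>\<close> and \<open>\<beta>\<close> can be compared, and
  then to \<open>E\<close> by \<open>S\<close>.  The metric mapping property, used for \<open>\<beta>\<close> along \<open>R\<close> and for \<open>\<alpha>\<close> along
  \<open>S\<close>, costs the factor \<open>(\<parallel>S\<parallel> \<parallel>R\<parallel>)\<^sup>n \<le> (l + \<epsilon>)\<^sup>n\<close> (\<open>factorization_estimate\<close>, \<open>tensor_map_factor\<close>).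
  Letting \<open>\<epsilon>\<close> tend to 0 bounds \<open>\<alpha>\<close> at the image of \<open>w\<close> in \<open>E\<close> by \<open>l\<^sup>n c\<close> times the \<open>\<beta>\<close>-norm of \<open>w\<close>
  over \<open>M\<close>; the infimum over all \<open>M\<close> and \<open>w\<close> is the finite hull.

  Two facts make this argument legitimate.  An s-tensor norm says nothing about spaces that are not
  normed, so \<open>\<ell>\<^sub>p\<^sup>m\<close> has to satisfy the triangle inequality, that is, Minkowski's inequality
  (\<open>normed_space_ellp_sum\<close>).  And the infimum has to be taken over a nonempty set: the finitely many
  vectors in a representation of a tensor span a space \<open>M\<close> over which the tensor already lives
  (\<open>sym_tensor_from_FIN\<close>).
\<close>

section \<open>Minkowski's inequality\<close>

text \<open>
  At the endpoint 0, where \<open>powr_convex\<close> is silent, convexity reduces to \<open>s\<^sup>p \<le> s\<close> for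
  \<open>0 \<le> s \<le> 1\<close>.
\<close>

lemma powr_convex_atLeast:
  fixes x y t p :: real
  assumes "1 \<le> p" "0 \<le> x" "0 \<le> y" "0 \<le> t" "t \<le> 1"
  shows "((1 - t) * x + t * y) powr p \<le> (1 - t) * x powr p + t * y powr p"
proof -
  have shrink: "(s * w) powr p \<le> s * w powr p" if "0 \<le> s" "s \<le> 1" for s w :: real
    using powr_mono'[of 1 p s] assms(1) that by (auto simp: powr_mult intro!: mult_right_mono)
  consider "x = 0" | "y = 0" | "0 < x" "0 < y"
    using assms by linarith
  then show ?thesis
  proof cases
    case 1
    then show ?thesis using shrink[of t y] assms by simp
  next
    case 2
    then show ?thesis using shrink[of "1 - t" x] assms by simp
  next
    case 3
    then show ?thesis
      using convex_onD[OF powr_convex[OF assms(1)], of t x y] assms by simp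
  qed
qed

text \<open>
  With \<open>a\<close> and \<open>b\<close> the norms of \<open>u\<close> and \<open>v\<close>, the vector \<open>(u + v) / (a + b)\<close> is a convex combination
  of the unit vectors \<open>u / a\<close> and \<open>v / b\<close>.  As the \<open>p\<close>-th power is convex, the sum of the \<open>p\<close>-th
  powers of its entries is at most 1.
\<close>

lemma Minkowski_powr_sum:
  fixes u v :: "'i \<Rightarrow> real"
  assumes p: "1 \<le> p" and A: "finite A"
    and u: "\<And>i. i \<in> A \<Longrightarrow> 0 \<le> u i" and v: "\<And>i. i \<in> A \<Longrightarrow> 0 \<le> v i"
  shows "(\<Sum>i\<in>A. (u i + v i) powr p) powr (1 / p)
    \<le> (\<Sum>i\<in>A. u i powr p) powr (1 / p) + (\<Sum>i\<in>A. v i powr p) powr (1 / p)"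
    (is "?N (\<lambda>i. u i + v i) \<le> ?N u + ?N v")
proof -
  have zero: "\<forall>i\<in>A. w i = 0" if "?N w = 0" for w :: "'i \<Rightarrow> real"
    using that A by (simp add: sum_nonneg_eq_0_iff)
  consider "?N u = 0" | "?N v = 0" | "0 < ?N u" "0 < ?N v"
    by (metis less_eq_real_def powr_ge_zero)
  then show ?thesis
  proof cases
    case 1
    with zero[of u] show ?thesis by simp
  next
    case 2
    with zero[of v] show ?thesis by simp
  next
    case 3
    define a b where "a = ?N u" and "b = ?N v"
    have ab: "0 < a" "0 < b" using 3 by (simp_all add: a_def b_def)
    have pw: "(\<Sum>i\<in>A. u i powr p) = a powr p" "(\<Sum>i\<in>A. v i powr p) = b powr p"
      using p by (auto simp: a_def b_def powr_powr sum_nonneg)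
    define t where "t = b / (a + b)"
    have t: "0 \<le> t" "t \<le> 1" "1 - t = a / (a + b)"
      using ab by (auto simp: t_def field_simps)
    have le: "((u i + v i) / (a + b)) powr p
        \<le> (1 - t) * (u i powr p / a powr p) + t * (v i powr p / b powr p)" if "i \<in> A" for i
    proof -
      have "(u i + v i) / (a + b) = (1 - t) * (u i / a) + t * (v i / b)"
        using ab unfolding t(3) by (simp add: t_def add_divide_distrib)
      then show ?thesis
        using powr_convex_atLeast[OF p, of "u i / a" "v i / b" t] u[OF that] v[OF that] ab t
        by (simp add: powr_divide)
    qed
    have "(\<Sum>i\<in>A. (u i + v i) powr p) / (a + b) powr p = (\<Sum>i\<in>A. ((u i + v i) / (a + b)) powr p)"
      using ab u v by (simp add: powr_divide sum_divide_distrib)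
    also have "\<dots> \<le> (\<Sum>i\<in>A. (1 - t) * (u i powr p / a powr p) + t * (v i powr p / b powr p))"
      using le by (rule sum_mono)
    also have "\<dots> = (1 - t) * ((\<Sum>i\<in>A. u i powr p) / a powr p)
        + t * ((\<Sum>i\<in>A. v i powr p) / b powr p)"
      by (simp add: sum.distrib sum_distrib_left sum_divide_distrib)
    also have "\<dots> = 1"
      using ab by (simp add: pw)
    finally have "(\<Sum>i\<in>A. (u i + v i) powr p) \<le> (a + b) powr p"
      using ab by (simp add: divide_le_eq)
    then have "?N (\<lambda>i. u i + v i) \<le> ((a + b) powr p) powr (1 / p)"
      using p by (intro powr_mono2) (auto intro: sum_nonneg)
    also have "\<dots> = a + b"
      using ab p by (simp add: powr_powr)
    finally show ?thesis by (simp add: a_def b_def)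
  qed
qed

section \<open>The normed spaces \<open>\<ell>\<^sub>p\<^sup>m\<close>\<close>

lemma real_of_ereal_ge_1: "1 \<le> p \<Longrightarrow> p \<noteq> \<infinity> \<Longrightarrow> 1 \<le> real_of_ereal p"
  by (cases p) auto

lemma lp_norm_nonneg: "0 \<le> lp_norm p m x"
  by (auto simp: lp_norm_def)

lemma lp_norm_eq_0_iff:
  assumes "1 \<le> p"
  shows "lp_norm p m x = 0 \<longleftrightarrow> (\<forall>i<m. x i = 0)"
proof (cases "p = \<infinity>")
  case True
  have "Max (insert 0 ((\<lambda>i. norm (x i)) ` {..<m})) = 0 \<longleftrightarrow> (\<forall>i<m. norm (x i) \<le> 0)"
    by (subst Max_eq_iff) auto
  then show ?thesis using True by (simp add: lp_norm_def)
next
  case False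
  then show ?thesis
    by (auto simp: lp_norm_def sum_nonneg_eq_0_iff)
qed

lemma lp_norm_triangle:
  assumes "1 \<le> p"
  shows "lp_norm p m (\<lambda>i. x i + y i) \<le> lp_norm p m x + lp_norm p m y"
proof (cases "p = \<infinity>")
  case True
  have ge: "norm (z i) \<le> lp_norm p m z" if "i < m" for z and i
    using that True by (auto simp: lp_norm_def)
  have "lp_norm p m (\<lambda>i. x i + y i) = Max (insert 0 ((\<lambda>i. norm (x i + y i)) ` {..<m}))"
    using True by (simp add: lp_norm_def)
  also have "\<dots> \<le> lp_norm p m x + lp_norm p m y"
    using ge[of _ x] ge[of _ y]
    by (auto intro!: add_nonneg_nonneg lp_norm_nonneg intro: norm_triangle_le add_mono)
  finally show ?thesis .
next
  case False
  define q where "q = real_of_ereal p"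
  have q: "1 \<le> q" using assms False by (simp add: q_def real_of_ereal_ge_1)
  have "lp_norm p m (\<lambda>i. x i + y i) = (\<Sum>i<m. norm (x i + y i) powr q) powr (1 / q)"
    using False by (simp add: lp_norm_def q_def)
  also have "\<dots> \<le> (\<Sum>i<m. (norm (x i) + norm (y i)) powr q) powr (1 / q)"
    using q by (intro powr_mono2 sum_mono) (auto intro: sum_nonneg norm_triangle_ineq)
  also have "\<dots> \<le> lp_norm p m x + lp_norm p m y"
    using Minkowski_powr_sum[OF q, of "{..<m}" "\<lambda>i. norm (x i)" "\<lambda>i. norm (y i)"] False
    by (simp add: lp_norm_def q_def)
  finally show ?thesis .
qed

lemma lp_norm_scale:
  assumes "1 \<le> p"
  shows "lp_norm p m (\<lambda>i. a * x i) = norm a * lp_norm p m x"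
proof (cases "p = \<infinity>")
  case True
  have "norm a * Max (insert 0 ((\<lambda>i. norm (x i)) ` {..<m}))
      = Max ((*) (norm a) ` insert 0 ((\<lambda>i. norm (x i)) ` {..<m}))"
    by (intro mono_Max_commute) (auto simp: mono_def mult_left_mono)
  then show ?thesis
    using True by (simp add: lp_norm_def image_image norm_mult)
next
  case False
  define q where "q = real_of_ereal p"
  have q: "1 \<le> q" using assms False by (simp add: q_def real_of_ereal_ge_1)
  have "(\<Sum>i<m. norm (a * x i) powr q) = norm a powr q * (\<Sum>i<m. norm (x i) powr q)"
    by (simp add: norm_mult powr_mult sum_distrib_left)
  then show ?thesis
    using False q by (simp add: lp_norm_def powr_mult powr_powr flip: q_def)
qed

lemma normed_space_ellp_sum:
  assumes "1 \<le> p"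
  shows "normed_space (ellp_sum p m :: ('k::real_normed_field, 'a + (nat \<Rightarrow> 'k)) nspace)"
    (is "normed_space ?L")
proof -
  have "Module.module scalars ?L"
  proof (rule moduleI)
    show "cring (scalars :: 'k ring)"
      using field_scalars by (auto simp: field_def domain_def)
    show "abelian_group ?L"
    proof (rule abelian_groupI)
      show "\<exists>y\<in>carrier ?L. y \<oplus>\<^bsub>?L\<^esub> x = \<zero>\<^bsub>?L\<^esub>" if "x \<in> carrier ?L" for x
        using that by (intro bexI[of _ "Inr (\<lambda>i. - projr x i)"]) (auto simp: ellp_sum_def ellp_def)
    qed (auto simp: ellp_sum_def ellp_def algebra_simps)
  qed (auto simp: ellp_sum_def ellp_def algebra_simps)
  moreover have "is_norm ?L (nrm ?L)"
  proof -
    have "lp_norm p m x = 0 \<longleftrightarrow> x = (\<lambda>i. 0)" if "\<forall>i\<ge>m. x i = 0" for x :: "nat \<Rightarrow> 'k"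
      using lp_norm_eq_0_iff[OF assms, of m x] that by (auto simp: fun_eq_iff) (metis not_less)
    then show ?thesis
      by (auto simp: is_norm_def ellp_sum_def ellp_def lp_norm_nonneg
          lp_norm_triangle[OF assms] lp_norm_scale[OF assms])
  qed
  ultimately show ?thesis
    by (simp add: normed_space_def)
qed

section \<open>Bounded operators\<close>

text \<open>
  The supremum of an unbounded or empty set of reals is unspecified.  Here the set contains the norm of
  \<open>T 0\<close> and is bounded because \<open>T\<close> is.
\<close>

lemma opnorm_nonneg:
  assumes E: "normed_space E" and F: "normed_space F" and T: "T \<in> bounded_ops E F"
  shows "0 \<le> opnorm E F T"
proof -
  interpret E: Module.module scalars E using E by (simp add: normed_space_def)
  have N: "is_norm E (nrm E)" "is_norm F (nrm F)" using E F by (auto simp: normed_space_def)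
  have cl: "T x \<in> carrier F" if "x \<in> carrier E" for x
    using T that by (auto simp: bounded_ops_def linear_op_def)
  obtain C where C: "\<And>x. x \<in> carrier E \<Longrightarrow> nrm F (T x) \<le> C * nrm E x"
    using T by (auto simp: bounded_ops_def)
  have bound: "nrm F (T x) \<le> \<bar>C\<bar>" if "x \<in> carrier E" "nrm E x \<le> 1" for x
  proof -
    have "C * nrm E x \<le> \<bar>C\<bar> * 1"
      using N that by (intro mult_mono) (auto simp: is_norm_def)
    with C[OF that(1)] show ?thesis by simp
  qed
  have "nrm E \<zero>\<^bsub>E\<^esub> = 0"
    using N by (simp add: is_norm_def)
  then have "nrm F (T \<zero>\<^bsub>E\<^esub>) \<le> opnorm E F T"
    unfolding opnorm_def using bound
    by (intro cSup_upper bdd_aboveI[of _ "\<bar>C\<bar>"]) force+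
  moreover have "0 \<le> nrm F (T \<zero>\<^bsub>E\<^esub>)"
    using N cl by (simp add: is_norm_def)
  ultimately show ?thesis by simp
qed

text \<open>
  The factorizations of an \<open>\<L>\<^sub>p\<close>-space go through \<open>ellp\<close>, the s-tensor norms are compared on
  \<open>ellp_sum\<close>.  The two spaces are isometric, so operators move between them with the same norm.
\<close>

lemma bounded_ops_into_ellp_sum:
  assumes "R \<in> bounded_ops M (ellp p m)"
  shows "(\<lambda>x. Inr (R x)) \<in> bounded_ops M (ellp_sum p m)"
    and "opnorm M (ellp_sum p m) (\<lambda>x. Inr (R x)) = opnorm M (ellp p m) R"
  using assms
  by (auto simp: bounded_ops_def linear_op_def opnorm_def ellp_sum_def Let_def Pi_iff)

lemma bounded_ops_from_ellp_sum:
  assumes "S \<in> bounded_ops (ellp p m) E"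
  shows "(\<lambda>u. S (projr u)) \<in> bounded_ops (ellp_sum p m) E"
    and "opnorm (ellp_sum p m) E (\<lambda>u. S (projr u)) = opnorm (ellp p m) E S"
proof -
  show "(\<lambda>u. S (projr u)) \<in> bounded_ops (ellp_sum p m) E"
    using assms by (auto simp: bounded_ops_def linear_op_def ellp_sum_def Let_def)
  have "{nrm E (S (projr u)) | u. u \<in> Inr ` carrier (ellp p m) \<and> nrm (ellp p m) (projr u) \<le> 1}
      = {nrm E (S x) | x. x \<in> carrier (ellp p m) \<and> nrm (ellp p m) x \<le> 1}"
    by force
  then show "opnorm (ellp_sum p m) E (\<lambda>u. S (projr u)) = opnorm (ellp p m) E S"
    unfolding opnorm_def by (intro arg_cong[of _ _ Sup]) (simp add: ellp_sum_def Let_def)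
qed

section \<open>Finite dimensional subspaces\<close>

lemma normed_space_FIN:
  assumes E: "normed_space E" and M: "M \<in> FIN E"
  shows "normed_space M"
proof -
  obtain H where H: "M = E\<lparr>carrier := H\<rparr>" "submodule H scalars E"
    using M by (auto simp: FIN_def)
  interpret E: Module.module scalars E using E by (simp add: normed_space_def)
  have "H \<subseteq> carrier E" using E.submoduleE(1)[OF H(2)] .
  moreover have "Module.module scalars M"
    unfolding H(1) using H(2) E.module_axioms by (rule submodule.submodule_is_module)
  ultimately show ?thesis
    using E by (auto simp: normed_space_def is_norm_def H(1) subset_iff)
qed

lemma span_in_FIN:
  assumes E: "normed_space E" and B: "finite B" "B \<subseteq> carrier E"
  obtains M where "M \<in> FIN E" and "B \<subseteq> carrier M"
proof -
  interpret E: Module.module scalars E using E by (simp add: normed_space_def)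
  have smult: "a \<odot>\<^bsub>E\<^esub> x \<in> carrier E" if "x \<in> carrier E" for a x
    using that E.smult_closed[of a x] by simp
  have Pi: "(\<lambda>b. a b \<odot>\<^bsub>E\<^esub> b) \<in> B \<rightarrow> carrier E" for a
    using B smult by auto
  define comb where "comb a = (\<Oplus>\<^bsub>E\<^esub>b\<in>B. a b \<odot>\<^bsub>E\<^esub> b)" for a
  define H where "H = {comb a | a. True}"
  have comb_closed: "comb a \<in> carrier E" for a
    unfolding comb_def using Pi by (rule E.M.finsum_closed)
  have comb_add: "comb a \<oplus>\<^bsub>E\<^esub> comb a' = comb (\<lambda>b. a b + a' b)" for a a'
  proof -
    have "comb a \<oplus>\<^bsub>E\<^esub> comb a' = (\<Oplus>\<^bsub>E\<^esub>b\<in>B. a b \<odot>\<^bsub>E\<^esub> b \<oplus>\<^bsub>E\<^esub> a' b \<odot>\<^bsub>E\<^esub> b)"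
      unfolding comb_def using Pi Pi by (rule E.M.finsum_addf[symmetric])
    also have "\<dots> = comb (\<lambda>b. a b + a' b)"
      unfolding comb_def using B smult E.smult_l_distr[of "a _" "a' _"]
      by (intro E.M.finsum_cong') (auto simp: subset_iff)
    finally show ?thesis .
  qed
  have comb_smult: "s \<odot>\<^bsub>E\<^esub> comb a = comb (\<lambda>b. s * a b)" for s a
  proof -
    have "s \<odot>\<^bsub>E\<^esub> comb a = (\<Oplus>\<^bsub>E\<^esub>b\<in>B. s \<odot>\<^bsub>E\<^esub> (a b \<odot>\<^bsub>E\<^esub> b))"
      unfolding comb_def using B Pi by (intro E.finsum_smult_ldistr) auto
    also have "\<dots> = comb (\<lambda>b. s * a b)"
      unfolding comb_def using B smult E.smult_assoc1[of s "a _"]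
      by (intro E.M.finsum_cong') (auto simp: subset_iff)
    finally show ?thesis .
  qed
  have comb_single: "comb (\<lambda>b. if b = x then 1 else 0) = x" if "x \<in> B" for x
  proof -
    have x: "x \<in> carrier E" using that B by auto
    have "comb (\<lambda>b. if b = x then 1 else 0) = (\<Oplus>\<^bsub>E\<^esub>b\<in>B. if x = b then b else \<zero>\<^bsub>E\<^esub>)"
      unfolding comb_def using B E.smult_l_null E.smult_one
      by (intro E.M.finsum_cong') (auto simp: subset_iff)
    also have "\<dots> = x"
      using that B by (intro E.M.finsum_singleton) auto
    finally show ?thesis .
  qed
  have HE: "H \<subseteq> carrier E"
    using comb_closed by (auto simp: H_def)
  have H_smult: "s \<odot>\<^bsub>E\<^esub> x \<in> H" if "x \<in> H" for s x
    using that comb_smult by (auto simp: H_def)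
  have sub: "submodule H scalars E"
  proof (rule E.submoduleI)
    have "\<zero>\<^bsub>E\<^esub> = 0 \<odot>\<^bsub>E\<^esub> comb (\<lambda>b. 0)"
      using E.smult_l_null[OF comb_closed] by simp
    then show "\<zero>\<^bsub>E\<^esub> \<in> H"
      using comb_smult by (auto simp: H_def)
    show "\<ominus>\<^bsub>E\<^esub> x \<in> H" if "x \<in> H" for x
      using E.smult_l_minus[of "\<one>\<^bsub>scalars\<^esub>" x] E.smult_one[of x] H_smult[OF that] that HE
      by (metis E.R.one_closed subsetD)
    show "x \<oplus>\<^bsub>E\<^esub> y \<in> H" if "x \<in> H" "y \<in> H" for x y
      using that comb_add by (auto simp: H_def)
  qed (use HE H_smult in auto)
  show ?thesis
  proof
    show "E\<lparr>carrier := H\<rparr> \<in> FIN E"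
      using sub B by (auto simp: FIN_def H_def comb_def)
    show "B \<subseteq> carrier (E\<lparr>carrier := H\<rparr>)"
    proof
      fix x assume "x \<in> B"
      then have "x = comb (\<lambda>b. if b = x then 1 else 0)"
        using comb_single by simp
      then show "x \<in> carrier (E\<lparr>carrier := H\<rparr>)"
        by (auto simp: H_def)
    qed
  qed
qed

section \<open>Tensors through a factorization\<close>

lemma linear_op_FIN_inclusion: "M \<in> FIN E \<Longrightarrow> normed_space E \<Longrightarrow> linear_op M E (\<lambda>x. x)"
  using module.submoduleE(1)
  by (fastforce simp: FIN_def linear_op_def normed_space_def)

text \<open>
  A representation of \<open>z\<close> uses finitely many vectors; the same representation, read in their span,
  defines \<open>w\<close>.
\<close>

lemma sym_tensor_from_FIN:
  assumes E: "normed_space E" and z: "z \<in> carrier (sym_tensors n E)"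
  obtains M w where "M \<in> FIN E" "w \<in> carrier (sym_tensors n M)" "tensor_map n M E (\<lambda>x. x) w = z"
proof -
  obtain r a x where rep: "represents n E r a x z"
    using z by (auto simp: sym_tensors_def)
  obtain M where M: "M \<in> FIN E" "x ` {..<r} \<subseteq> carrier M"
    using span_in_FIN[OF E, of "x ` {..<r}"] rep by (auto simp: represents_def)
  define w where "w = (\<lambda>\<phi>. \<Sum>j<r. a j * power_tensor n M (x j) \<phi>)"
  have w: "represents n M r a x w"
    using M by (auto simp: represents_def w_def)
  have "represents n E r a x (tensor_map n M E (\<lambda>x. x) w)"
    using tensor_map_represents[OF _ linear_op_FIN_inclusion[OF M(1) E] w] normed_space_FIN[OF E M(1)]
    by (simp add: normed_space_def)
  then have "tensor_map n M E (\<lambda>x. x) w = z"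
    using rep by (simp add: represents_def)
  moreover have "w \<in> carrier (sym_tensors n M)"
    using w by (auto simp: sym_tensors_def)
  ultimately show ?thesis using M(1) that by blast
qed

lemma tensor_map_closed:
  assumes "normed_space E" "T \<in> bounded_ops E F" "z \<in> carrier (sym_tensors n E)"
  shows "tensor_map n E F T z \<in> carrier (sym_tensors n F)"
  using assms tensor_map_represents[of E F T n]
  by (fastforce simp: sym_tensors_def normed_space_def bounded_ops_def)

text \<open>
  Functoriality of the symmetric tensor power: as the tensors are combinations of powers, both sides
  can be read off from one representation of \<open>w\<close>.
\<close>

lemma tensor_map_factor:
  assumes M: "normed_space M" and L: "normed_space L"
    and R: "R \<in> bounded_ops M L" and S: "S \<in> bounded_ops L E" and J: "linear_op M E J"
    and SR: "\<And>x. x \<in> carrier M \<Longrightarrow> S (R x) = J x"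
    and w: "w \<in> carrier (sym_tensors n M)"
  shows "tensor_map n L E S (tensor_map n M L R w) = tensor_map n M E J w"
proof -
  obtain r a x where rep: "represents n M r a x w"
    using w by (auto simp: sym_tensors_def)
  have m: "Module.module scalars M" "Module.module scalars L"
    using M L by (auto simp: normed_space_def)
  have l: "linear_op M L R" "linear_op L E S"
    using R S by (auto simp: bounded_ops_def)
  have "represents n E r a (\<lambda>j. S (R (x j))) (tensor_map n L E S (tensor_map n M L R w))"
    using tensor_map_represents[OF m(2) l(2) tensor_map_represents[OF m(1) l(1) rep]] .
  moreover have "represents n E r a (\<lambda>j. J (x j)) (tensor_map n M E J w)"
    using tensor_map_represents[OF m(1) J rep] .
  ultimately show ?thesis
    using SR rep by (simp add: represents_def)
qed

lemma s_tensor_norm_nonneg: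
  assumes "s_tensor_norm n \<alpha>" "normed_space E" "z \<in> carrier (sym_tensors n E)"
  shows "0 \<le> \<alpha> E z"
  using assms by (auto simp: s_tensor_norm_def is_norm_def)

lemma s_tensor_norm_metric_mapping:
  assumes "s_tensor_norm n \<alpha>" "normed_space E" "normed_space F" "T \<in> bounded_ops E F"
    "z \<in> carrier (sym_tensors n E)"
  shows "\<alpha> F (tensor_map n E F T z) \<le> opnorm E F T ^ n * \<alpha> E z"
  using assms by (auto simp: s_tensor_norm_def)

text \<open>
  The space \<open>L\<close> on which \<open>\<alpha>\<close> and \<open>\<beta>\<close> are comparable is entered with \<open>\<beta>\<close> and left with \<open>\<alpha>\<close>, so each
  of the two operators contributes its norm to the power \<open>n\<close>.
\<close>

lemma factorization_estimate:
  assumes \<alpha>: "s_tensor_norm n \<alpha>" and \<beta>: "s_tensor_norm n \<beta>" and c: "0 \<le> c"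
    and le: "\<forall>z\<in>carrier (sym_tensors n L). \<alpha> L z \<le> c * \<beta> L z"
    and M: "normed_space M" and L: "normed_space L" and E: "normed_space E"
    and R: "R \<in> bounded_ops M L" and S: "S \<in> bounded_ops L E"
    and w: "w \<in> carrier (sym_tensors n M)"
  shows "\<alpha> E (tensor_map n L E S (tensor_map n M L R w))
    \<le> (opnorm L E S * opnorm M L R) ^ n * c * \<beta> M w"
proof -
  let ?v = "tensor_map n M L R w"
  have v: "?v \<in> carrier (sym_tensors n L)"
    using tensor_map_closed[OF M R w] .
  have "\<alpha> E (tensor_map n L E S ?v) \<le> opnorm L E S ^ n * \<alpha> L ?v"
    using s_tensor_norm_metric_mapping[OF \<alpha> L E S v] .
  also have "\<dots> \<le> opnorm L E S ^ n * (c * (opnorm M L R ^ n * \<beta> M w))"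
  proof (intro mult_left_mono)
    show "\<alpha> L ?v \<le> c * (opnorm M L R ^ n * \<beta> M w)"
      using le v s_tensor_norm_metric_mapping[OF \<beta> M L R w] c
      by (meson mult_left_mono order_trans)
  qed (use opnorm_nonneg[OF L E S] in auto)
  also have "\<dots> = (opnorm L E S * opnorm M L R) ^ n * c * \<beta> M w"
    by (simp add: power_mult_distrib)
  finally show ?thesis .
qed

theorem lemma2p9:
  fixes n :: nat and p :: ereal and l c :: real
    and \<alpha> \<beta> :: "('k::real_normed_field, 'a + (nat \<Rightarrow> 'k)) nspace \<Rightarrow>
      ('k, 'a + (nat \<Rightarrow> 'k)) tensor \<Rightarrow> real"
    and E :: "('k, 'a + (nat \<Rightarrow> 'k)) nspace"
  assumes "1 \<le> p" and "1 \<le> l"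
    and "s_tensor_norm n \<alpha>" and "s_tensor_norm n \<beta>"
    and "0 \<le> c"
    and "\<forall>m. \<forall>z\<in>carrier (sym_tensors n (ellp_sum p m :: ('k, 'a + (nat \<Rightarrow> 'k)) nspace)).
           \<alpha> (ellp_sum p m) z \<le> c * \<beta> (ellp_sum p m) z"
    and "normed_space E" and "Lg_space p l E"
  shows "\<forall>z\<in>carrier (sym_tensors n E). \<alpha> E z \<le> l ^ n * c * finite_hull n \<beta> E z"
proof
  fix z assume z: "z \<in> carrier (sym_tensors n E)"
  have bound: "\<alpha> E z \<le> l ^ n * c * \<beta> M w"
    if M: "M \<in> FIN E" and w: "w \<in> carrier (sym_tensors n M)"
      and wz: "tensor_map n M E (\<lambda>x. x) w = z" for M w
  proof -
    have NM: "normed_space M"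
      using normed_space_FIN[OF assms(7) M] .
    have eps: "\<alpha> E z \<le> (l + \<epsilon>) ^ n * c * \<beta> M w" if "0 < \<epsilon>" for \<epsilon>
    proof -
      obtain m R S where R: "R \<in> bounded_ops M (ellp p m)" and S: "S \<in> bounded_ops (ellp p m) E"
        and SR: "\<forall>x\<in>carrier M. S (R x) = x"
        and norms: "opnorm (ellp p m) E S * opnorm M (ellp p m) R \<le> l + \<epsilon>"
        using assms(8) M \<open>0 < \<epsilon>\<close> unfolding Lg_space_def by meson
      let ?L = "ellp_sum p m :: ('k, 'a + (nat \<Rightarrow> 'k)) nspace"
      let ?R = "\<lambda>x. Inr (R x) :: 'a + (nat \<Rightarrow> 'k)" and ?S = "\<lambda>u :: 'a + (nat \<Rightarrow> 'k). S (projr u)"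
      have L: "normed_space ?L"
        using normed_space_ellp_sum[OF assms(1)] .
      have R': "?R \<in> bounded_ops M ?L" "opnorm M ?L ?R = opnorm M (ellp p m) R"
        using bounded_ops_into_ellp_sum[OF R] by blast+
      have S': "?S \<in> bounded_ops ?L E" "opnorm ?L E ?S = opnorm (ellp p m) E S"
        using bounded_ops_from_ellp_sum[OF S] by blast+
      have "tensor_map n ?L E ?S (tensor_map n M ?L ?R w) = z"
        using tensor_map_factor[OF NM L R'(1) S'(1) linear_op_FIN_inclusion[OF M assms(7)] _ w] SR wz
        by simp
      then have "\<alpha> E z \<le> (opnorm ?L E ?S * opnorm M ?L ?R) ^ n * c * \<beta> M w"
        using factorization_estimate[OF assms(3,4,5) assms(6)[rule_format, THEN ballI] NM L assms(7)
            R'(1) S'(1) w]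
        by simp
      also have "\<dots> \<le> (l + \<epsilon>) ^ n * c * \<beta> M w"
        using norms opnorm_nonneg[OF NM L R'(1)] opnorm_nonneg[OF L assms(7) S'(1)] assms(5)
          s_tensor_norm_nonneg[OF assms(4) NM w]
        by (intro mult_right_mono power_mono) (auto simp: R'(2) S'(2))
      finally show ?thesis .
    qed
    show ?thesis
    proof (rule tendsto_lowerbound)
      show "((\<lambda>\<epsilon>. (l + \<epsilon>) ^ n * c * \<beta> M w) \<longlongrightarrow> l ^ n * c * \<beta> M w) (at_right 0)"
        by (auto intro!: tendsto_eq_intros)
      show "\<forall>\<^sub>F \<epsilon> in at_right 0. \<alpha> E z \<le> (l + \<epsilon>) ^ n * c * \<beta> M w"
        using eps by (auto intro: eventually_at_rightI[of 0 1])
    qed simp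
  qed
  let ?A = "{\<beta> M w | M w. M \<in> FIN E \<and> w \<in> carrier (sym_tensors n M) \<and>
     tensor_map n M E (\<lambda>x. x) w = z}"
  have ne: "?A \<noteq> {}"
    using sym_tensor_from_FIN[OF assms(7) z] by blast
  have bnd: "\<alpha> E z \<le> l ^ n * c * t" if "t \<in> ?A" for t
    using that bound by auto
  show "\<alpha> E z \<le> l ^ n * c * finite_hull n \<beta> E z"
    \<comment> \<open>For \<open>c = 0\<close> the constant cannot be moved out of the infimum by division; one pair \<open>M, w\<close>
      suffices then.\<close>
  proof (cases "c = 0")
    case True
    with ne bnd show ?thesis by auto
  next
    case False
    then have K: "0 < l ^ n * c" using assms(2,5) by simp
    have "\<alpha> E z / (l ^ n * c) \<le> finite_hull n \<beta> E z"
      unfolding finite_hull_def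
    proof (rule cInf_greatest[OF ne])
      show "\<alpha> E z / (l ^ n * c) \<le> t" if "t \<in> ?A" for t
        using bnd[OF that] K by (simp add: divide_le_eq mult.commute)
    qed
    with K show ?thesis by (simp add: divide_le_eq mult.commute)
  qed
qed

end
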